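(* Let $n$ be a positive integer. The function $$F_n(h)=\frac{\oint_{\Gamma_h} u^n y\,du}{\oint_{\Gamma_h} y\,du}$$ is monotonically decreasing for $h\in\left(-\frac{n(n+1)^{2/n}}{2(n+2)},\,0\right)$.
   Context: For a positive integer $n$ consider the planar Hamiltonian system $$\frac{du}{d\eta}=y,\qquad \frac{dy}{d\eta}=u-\frac{1}{n+1}u^{n+1},$$ with Hamiltonian function $$H(u,y)=\frac{y^2}{2}-\frac{u^2}{2}+\frac{u^{n+2}}{(n+1)(n+2)}.$$ The point $(\sqrt[n]{n+1},0)$ is a center with $H(\sqrt[n]{n+1},0)=-\frac{n(n+1)^{2/n}}{2(n+2)}$, and $(0,0)$ is a saddle with $H(0,0)=0$. For $h\in\left(-\frac{n(n+1)^{2/n}}{2(n+2)},0\right)$, $\Gamma_h$ denotes the closed trajectory $H(u,y)=h$ surrounding the center $(\sqrt[n]{n+1},0)$ (i.e. the closed level curve of $H$ lying in the half-plane $u>0$). These curves form a periodic annulus around $(\sqrt[n]{n+1},0)$. Both line integrals are taken along $\Gamma_h$ with the same orientation (that of the flow, clockwise, for which $\oint_{\Gamma_h}y\,du$ equals the enclosed area and is positive). *)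

theory Defs
  imports "HOL-Analysis.Analysis"
begin

definition vector_field :: "nat \<Rightarrow> real \<times> real \<Rightarrow> real \<times> real" where
  "vector_field n = (\<lambda>(u, y). (y, u - u ^ (n + 1) / real (n + 1)))"

definition hamiltonian :: "nat \<Rightarrow> real \<times> real \<Rightarrow> real" where
  "hamiltonian n = (\<lambda>(u, y). y ^ 2 / 2 - u ^ 2 / 2 + u ^ (n + 2) / (real (n + 1) * real (n + 2)))"

definition center_energy :: "nat \<Rightarrow> real" where
  "center_energy n = - (real n * real (n + 1) powr (2 / real n) / (2 * real (n + 2)))"

definition oval :: "nat \<Rightarrow> real \<Rightarrow> (real \<times> real) set" where
  "oval n h = {p. fst p > 0 \<and> hamiltonian n p = h}"

text \<open>
  A periodic solution \<open>\<gamma>\<close> of the system with minimal period \<open>T\<close> whose orbit is \<open>C\<close>.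
  Following the flow fixes the orientation (clockwise), and injectivity on one period
  ensures that \<open>C\<close> is traversed exactly once.
\<close>
definition closed_trajectory ::
  "nat \<Rightarrow> (real \<times> real) set \<Rightarrow> (real \<Rightarrow> real \<times> real) \<Rightarrow> real \<Rightarrow> bool" where
  "closed_trajectory n C \<gamma> T \<longleftrightarrow>
     T > 0 \<and>
     (\<forall>t. (\<gamma> has_vector_derivative vector_field n (\<gamma> t)) (at t)) \<and>
     (\<forall>t. \<gamma> (t + T) = \<gamma> t) \<and>
     inj_on \<gamma> {0..<T} \<and>
     \<gamma> ` {0..<T} = C"

text \<open>
  The line integral of the one-form \<open>f du\<close> along the closed trajectory \<open>C\<close>. Two
  parametrizations of \<open>C\<close> by the flow differ only by a time shift, so the described value
  does not depend on the parametrization.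
\<close>
definition line_integral_du ::
  "nat \<Rightarrow> (real \<times> real) set \<Rightarrow> (real \<times> real \<Rightarrow> real) \<Rightarrow> real" where
  "line_integral_du n C f =
     (THE I. \<exists>\<gamma> T. closed_trajectory n C \<gamma> T \<and>
        ((\<lambda>t. f (\<gamma> t) * deriv (\<lambda>s. fst (\<gamma> s)) t) has_integral I) {0..T})"

definition F_ratio :: "nat \<Rightarrow> real \<Rightarrow> real" where
  "F_ratio n h = line_integral_du n (oval n h) (\<lambda>(u, y). u ^ n * y) /
           line_integral_du n (oval n h) (\<lambda>(u, y). y)"

end

theory Submission imports Defs begin

text \<open>
  The potential well \<open>\<Phi> u = u ^ (n + 2) / ((n + 1) * (n + 2)) - u\<^sup>2 / 2\<close> has its minimum, the center
  energy \<open>E\<close>, at \<open>c\<close> with \<open>c ^ n = n + 1\<close>. Write \<open>\<Phi> - E = q\<^sup>2 / 2\<close> with \<open>q\<close> a smooth increasing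
  function of \<open>u > 0\<close> that vanishes at \<open>c\<close>. In the coordinates \<open>(q, y)\<close> the oval of energy \<open>h\<close> is the
  circle of radius \<open>R = sqrt (2 * (h - E))\<close>, and with \<open>z = y + i * q\<close> the system becomes
  \<open>z' = i * q' u * z\<close>: every trajectory on the oval is the circle run through with a positive
  angular speed. This yields both that a periodic parametrization exists
  (\<open>closed_trajectory_exists\<close>) and that any of them turns exactly once (\<open>angle_of_trajectory\<close>).
  Hence the line integral of \<open>\<phi> u * y du\<close> is
  \<open>2 * \<integral> (\<phi> b / q' b + \<phi> a / q' a) * sqrt (R\<^sup>2 - s\<^sup>2) ds\<close> over \<open>0 \<le> s \<le> R\<close>, where \<open>a < c < b\<close> are
  the two points with \<open>q a = - s\<close>, \<open>q b = s\<close>, that is, with equal potential energy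
  (\<open>line_integral_du_level\<close>).

  Two monotonicity facts finish the argument. For \<open>R < R'\<close> the quotient of the kernels
  \<open>sqrt (R'\<^sup>2 - s\<^sup>2) / sqrt (R\<^sup>2 - s\<^sup>2)\<close> increases in \<open>s\<close>, so enlarging \<open>R\<close> moves weight to larger \<open>s\<close>;
  a weighted mean of a decreasing function therefore decreases (\<open>weighted_ratio_decreasing\<close>).
  The function averaged here is the quotient of the brackets for \<open>\<phi> u = u ^ n\<close> and \<open>\<phi> u = 1\<close>.
  Since \<open>\<Phi>' u = u * (u ^ n / (n + 1) - 1)\<close>, it equals \<open>(n + 1) * (1 - 1 / K)\<close> with
  \<open>K = (a / (b - a)) / (b ^ n / (n + 1) - 1) + (b / (b - a)) / (1 - a ^ n / (n + 1))\<close>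
  (\<open>folded_ratio\<close>). As \<open>s\<close> grows, \<open>a\<close> decreases and \<open>b\<close> increases, and each of the four
  positive factors in \<open>K\<close> decreases (\<open>recip_defect_strict_decreasing\<close>).
\<close>

section \<open>Means with respect to circular kernels\<close>

text \<open>
  A likelihood-ratio argument: let \<open>c\<close> be the mean of \<open>f / g\<close> for the radius \<open>R\<close>, and let \<open>x\<close> be the
  point where \<open>f / g\<close> takes the value \<open>c\<close>. Then \<open>D = f - c * g\<close> changes sign from plus to minus at \<open>x\<close>.
  With \<open>l\<close> the kernel quotient at \<open>x\<close>, the \<open>R'\<close>-kernel minus \<open>l\<close> times the \<open>R\<close>-kernel changes sign from
  minus to plus at \<open>x\<close>, so its product with \<open>D\<close> is nowhere positive on \<open>[0, R]\<close>; between \<open>R\<close> and \<open>R'\<close>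
  the function \<open>D\<close> is negative, which makes the inequality strict.
\<close>
lemma weighted_ratio_decreasing:
  fixes f g :: "real \<Rightarrow> real"
  assumes "0 < R" "R < R'"
    and cont: "continuous_on {0..R'} f" "continuous_on {0..R'} g"
    and pos: "\<And>s. s \<in> {0..R'} \<Longrightarrow> 0 < g s"
    and dec: "\<And>s t. 0 \<le> s \<Longrightarrow> s < t \<Longrightarrow> t \<le> R' \<Longrightarrow> f t / g t < f s / g s"
  shows "integral {0..R'} (\<lambda>s. f s * sqrt (R'\<^sup>2 - s\<^sup>2)) / integral {0..R'} (\<lambda>s. g s * sqrt (R'\<^sup>2 - s\<^sup>2))
       < integral {0..R} (\<lambda>s. f s * sqrt (R\<^sup>2 - s\<^sup>2)) / integral {0..R} (\<lambda>s. g s * sqrt (R\<^sup>2 - s\<^sup>2))"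
proof -
  define w where "w = (\<lambda>r s::real. sqrt (r\<^sup>2 - s\<^sup>2))"
  have w_pos: "0 < w r s" if "0 \<le> s" "s < r" for r s
    using that power_strict_mono[of s r 2] by (simp add: w_def)
  have w_cont: "continuous_on A (w r)" for A r
    unfolding w_def by (intro continuous_intros)
  have sub: "continuous_on {a..b} h" if "continuous_on {0..R'} h" "0 \<le> a" "b \<le> R'"
    for a b and h :: "real \<Rightarrow> real"
    using continuous_on_subset[OF that(1)] that by auto
  have int: "(\<lambda>s. h s * w r s) integrable_on {a..b}"
    if "continuous_on {0..R'} h" "0 \<le> a" "b \<le> R'" for a b r h
    using sub[OF that] w_cont by (intro integrable_continuous_real continuous_intros)
  define J where "J = (\<lambda>h r. integral {0..r} (\<lambda>s. h s * w r s))"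
  have J_pos: "0 < J h r" if "0 < r" "r \<le> R'" "continuous_on {0..R'} h"
    "\<And>s. 0 < s \<Longrightarrow> s < r \<Longrightarrow> 0 < h s" for h r
  proof -
    have "integral {0..r} (\<lambda>s. 0) < integral {0..r} (\<lambda>s. h s * w r s)"
      using that sub[OF that(3), of 0 r] w_cont w_pos
      by (intro integral_less_real continuous_intros) auto
    then show ?thesis by (simp add: J_def)
  qed
  have Jg: "0 < J g R" "0 < J g R'"
    using assms by (auto intro!: J_pos)
  define c where "c = J f R / J g R"
  define D where "D = (\<lambda>s. f s - c * g s)"
  have D_cont: "continuous_on {0..R'} D"
    unfolding D_def by (intro continuous_intros cont)
  have D_alt: "D s = g s * (f s / g s - c)" if "s \<in> {0..R'}" for s
    using pos[OF that] by (simp add: D_def field_simps)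
  have JD: "J D r = J f r - c * J g r" if "r \<in> {R, R'}" for r
  proof -
    have "J D r = integral {0..r} (\<lambda>s. f s * w r s - c * (g s * w r s))"
      by (simp add: J_def D_def algebra_simps)
    also have "\<dots> = J f r - c * J g r"
      using that assms unfolding J_def
      by (subst integral_diff) (auto intro!: int integrable_on_mult_right)
    finally show ?thesis .
  qed
  have JDR: "J D R = 0" using Jg by (simp add: JD c_def)
  \<comment> \<open>\<open>D\<close> is continuous and its weighted integral over \<open>[0, R]\<close> is zero, so it has a zero inside.\<close>
  obtain x where x: "0 < x" "x < R" "D x = 0"
  proof -
    have "\<exists>a\<in>{0<..<R}. D a \<le> 0"
    proof (rule ccontr)
      assume "\<not> ?thesis"
      then have "0 < J D R"
        using assms by (intro J_pos D_cont) (auto simp: not_le)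
      then show False using JDR by simp
    qed
    moreover have "\<exists>b\<in>{0<..<R}. 0 \<le> D b"
    proof (rule ccontr)
      assume "\<not> ?thesis"
      then have "0 < J (\<lambda>s. - D s) R"
        using assms by (intro J_pos continuous_intros D_cont) (auto simp: not_le)
      then show False using JDR by (simp add: J_def)
    qed
    ultimately obtain a b where ab: "a \<in> {0<..<R}" "D a \<le> 0" "b \<in> {0<..<R}" "0 \<le> D b"
      by blast
    have "\<exists>x. x \<in> {min a b..max a b} \<and> D x = 0"
    proof (cases "a \<le> b")
      case True
      then show ?thesis using IVT'[of D a 0 b] ab sub[OF D_cont, of a b] assms
        by force
    next
      case False
      then show ?thesis using IVT2'[of D a 0 b] ab sub[OF D_cont, of b a] assms
        by force
    qed
    then obtain x where "min a b \<le> x" "x \<le> max a b" "D x = 0" by auto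
    moreover from this have "0 < x" "x < R" using ab by (auto simp: min_def max_def split: if_splits)
    ultimately show ?thesis using that by blast
  qed
  have c: "c = f x / g x"
    using x pos[of x] assms(1,2) by (auto simp: D_def field_simps)
  have D_pos: "0 < D s" if "0 \<le> s" "s < x" for s
  proof -
    have "0 < g s * (f s / g s - c)"
      using that x assms dec[of s x] pos[of s] unfolding c by (intro mult_pos_pos) auto
    then show ?thesis using that x assms by (simp add: D_alt)
  qed
  have D_neg: "D s < 0" if "x < s" "s \<le> R'" for s
  proof -
    have "g s * (f s / g s - c) < 0"
      using that x assms dec[of x s] pos[of s] unfolding c by (intro mult_pos_neg) auto
    then show ?thesis using that x assms by (simp add: D_alt)
  qed
  define l where "l = w R' x / w R x"
  have wx: "0 < w R x" "0 < w R' x" using x assms by (auto intro!: w_pos)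
  have l_sq: "l\<^sup>2 = (R'\<^sup>2 - x\<^sup>2) / (R\<^sup>2 - x\<^sup>2)"
    using x assms power_mono[of x R 2] power_mono[of x R' 2]
    by (simp add: l_def power_divide w_def)
  have sq: "x\<^sup>2 < R\<^sup>2" "R\<^sup>2 < R'\<^sup>2"
    using x assms by (auto intro!: power_strict_mono)
  have key: "(w R' s)\<^sup>2 - (l * w R s)\<^sup>2 = (R'\<^sup>2 - R\<^sup>2) * (s\<^sup>2 - x\<^sup>2) / (R\<^sup>2 - x\<^sup>2)"
    if "0 \<le> s" "s \<le> R" for s
  proof -
    have "s\<^sup>2 \<le> R\<^sup>2" using that by (auto intro!: power_mono)
    then have "(w R' s)\<^sup>2 - (l * w R s)\<^sup>2 = (R'\<^sup>2 - s\<^sup>2) - l\<^sup>2 * (R\<^sup>2 - s\<^sup>2)"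
      using sq by (simp add: w_def power_mult_distrib)
    then show ?thesis using sq unfolding l_sq by (simp add: field_simps)
  qed
  have sgn: "D s * w R' s \<le> l * (D s * w R s)" if s: "0 \<le> s" "s \<le> R" for s
  proof -
    have nn: "0 \<le> w R' s" "0 \<le> l * w R s"
      using s assms power_mono[of s R 2] power_mono[of s R' 2] wx by (auto simp: w_def l_def)
    consider "s < x" | "s = x" | "x < s" by linarith
    then have "D s * (w R' s - l * w R s) \<le> 0"
    proof cases
      case 1
      then have "s\<^sup>2 < x\<^sup>2" using s by (auto intro!: power_strict_mono)
      then have "(w R' s)\<^sup>2 \<le> (l * w R s)\<^sup>2" 
        using key[OF s] sq by (smt (verit) divide_nonneg_pos divide_nonpos_pos mult_nonneg_nonpos)
      then show ?thesis using D_pos[of s] 1 s nn power2_le_imp_le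
        by (smt (verit) mult_nonneg_nonpos)
    next
      case 3
      then have "x\<^sup>2 < s\<^sup>2" using x by (auto intro!: power_strict_mono)
      then have "(l * w R s)\<^sup>2 \<le> (w R' s)\<^sup>2" 
        using key[OF s] sq by (smt (verit) divide_nonneg_pos mult_nonneg_nonneg)
      then show ?thesis using D_neg[of s] 3 s nn power2_le_imp_le assms
        by (smt (verit) mult_nonpos_nonneg)
    qed (simp add: x)
    then show ?thesis by (simp add: algebra_simps)
  qed
  have "integral {0..R} (\<lambda>s. D s * w R' s) \<le> integral {0..R} (\<lambda>s. l * (D s * w R s))"
    using sgn assms int[OF D_cont, of 0 R] 
    by (intro integral_le integrable_on_mult_right) auto
  also have "\<dots> = 0" using JDR by (simp add: J_def)
  finally have 1: "integral {0..R} (\<lambda>s. D s * w R' s) \<le> 0" .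
  have "integral {R..R'} (\<lambda>s. D s * w R' s) < integral {R..R'} (\<lambda>s. 0)"
    using assms x sub[OF D_cont, of R R'] w_cont w_pos D_neg
    by (intro integral_less_real continuous_intros) (auto intro!: mult_neg_pos)
  with 1 have "J D R' < 0"
    using assms int[OF D_cont, of 0 R' R']
      Henstock_Kurzweil_Integration.integral_combine[where a = 0 and b = R' and c = R and f = "\<lambda>s. D s * w R' s"]
    by (simp add: J_def)
  then have "J f R' < c * J g R'" by (simp add: JD)
  then have "J f R' / J g R' < J f R / J g R"
    using Jg by (simp add: c_def field_simps)
  then show ?thesis by (simp add: J_def w_def)
qed

section \<open>Motion in a potential that is a square\<close>

lemma continuous_antiderivative:
  fixes f :: "real \<Rightarrow> real"
  assumes "a < b" "continuous_on (einterval a b) f"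
  obtains F where "\<And>x. x \<in> einterval a b \<Longrightarrow> (F has_real_derivative f x) (at x)"
proof -
  have "isCont f x" if "a < ereal x" "ereal x < b" for x
    using assms(2) that continuous_on_interior[of "einterval a b" f x]
    by (simp add: interior_open einterval_iff)
  from einterval_antiderivative[OF assms(1) this] show ?thesis
    using that by (auto simp: einterval_iff has_real_derivative_iff_has_vector_derivative)
qed

lemmas continuous_antiderivative_UNIV =
  continuous_antiderivative[of "- \<infinity>" "\<infinity>", simplified]

text \<open>
  For \<open>u > 0\<close> the system is the Newton equation for the potential \<open>q\<^sup>2 / 2\<close>. Because \<open>q\<close> attains
  every value in \<open>(- \<rho>, \<rho>)\<close>, the level sets with \<open>R < \<rho>\<close> are full circles in the coordinates \<open>(q, y)\<close>.
\<close>
locale squared_potential =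
  fixes n :: nat and q q' :: "real \<Rightarrow> real" and \<rho> :: real
  assumes q_deriv: "0 < u \<Longrightarrow> (q has_real_derivative q' u) (at u)"
    and q'_pos: "0 < u \<Longrightarrow> 0 < q' u"
    and q'_cont: "continuous_on {0<..} q'"
    and q_onto: "\<bar>s\<bar> < \<rho> \<Longrightarrow> \<exists>u>0. q u = s"
    and field: "0 < u \<Longrightarrow> vector_field n (u, y) = (y, - (q u * q' u))"
begin

definition q_inv :: "real \<Rightarrow> real" where
  "q_inv s = (THE u. 0 < u \<and> q u = s)"

definition level :: "real \<Rightarrow> (real \<times> real) set" where
  "level R = {p. 0 < fst p \<and> (snd p)\<^sup>2 + (q (fst p))\<^sup>2 = R\<^sup>2}"

text \<open>
  The angle is measured from the \<open>y\<close> axis towards \<open>q\<close>, the clockwise sense of the flow.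
\<close>
definition point :: "real \<Rightarrow> real \<Rightarrow> real \<times> real" where
  "point R \<theta> = (q_inv (R * sin \<theta>), R * cos \<theta>)"

lemma q_strict_mono: "0 < u \<Longrightarrow> u < v \<Longrightarrow> q u < q v"
  by (rule DERIV_pos_imp_increasing[of u v q]) (auto intro!: q_deriv q'_pos exI)

lemma q_inj: "0 < u \<Longrightarrow> 0 < v \<Longrightarrow> q u = q v \<Longrightarrow> u = v"
  using q_strict_mono[of u v] q_strict_mono[of v u] by (cases u v rule: linorder_cases) auto

lemma q_inv_q: "0 < u \<Longrightarrow> q_inv (q u) = u"
  unfolding q_inv_def using q_inj by blast

lemma q_inv_pos: "\<bar>s\<bar> < \<rho> \<Longrightarrow> 0 < q_inv s"
  and q_q_inv: "\<bar>s\<bar> < \<rho> \<Longrightarrow> q (q_inv s) = s"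
  using q_onto[of s] q_inv_q by auto

lemma q_inv_strict_mono: "\<bar>s\<bar> < \<rho> \<Longrightarrow> \<bar>t\<bar> < \<rho> \<Longrightarrow> s < t \<Longrightarrow> q_inv s < q_inv t"
  using q_strict_mono[of "q_inv t" "q_inv s"] q_inv_pos[of s] q_inv_pos[of t] q_q_inv[of s] q_q_inv[of t]
  by (cases "q_inv s" "q_inv t" rule: linorder_cases) auto

lemma q_inv_isCont:
  assumes "\<bar>s\<bar> < \<rho>"
  shows "isCont q_inv s"
proof -
  have "isCont q_inv (q (q_inv s))"
  proof (rule isCont_inverse_function2[where f = q and x = "q_inv s" and a = "q_inv s / 2" and b = "2 * q_inv s"])
    show "isCont q z" if "q_inv s / 2 \<le> z" for z
      using q_deriv[of z] DERIV_isCont that q_inv_pos[OF assms] by auto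
  qed (use q_inv_pos[OF assms] q_inv_q in auto)
  then show ?thesis by (simp add: q_q_inv assms)
qed

lemma q_inv_deriv:
  assumes "\<bar>s\<bar> < \<rho>"
  shows "(q_inv has_real_derivative inverse (q' (q_inv s))) (at s)"
  by (rule DERIV_inverse_function[of q _ _ _ "- \<rho>" "\<rho>"])
     (use assms in \<open>auto intro!: q_deriv q_inv_pos q_q_inv q_inv_isCont less_imp_neq[THEN not_sym] q'_pos\<close>)

lemma R_sin_less:
  assumes "0 < R" "R < \<rho>"
  shows "\<bar>R * sin \<theta>\<bar> < \<rho>"
proof -
  have "\<bar>R * sin \<theta>\<bar> = R * \<bar>sin \<theta>\<bar>" using assms by (simp add: abs_mult)
  also have "\<dots> \<le> R" using assms by (intro mult_left_le abs_sin_le_one) simp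
  finally show ?thesis using assms by simp
qed

lemma level_eq:
  assumes "0 < R" "R < \<rho>"
  shows "level R = point R ` {0..<2 * pi}"
proof (intro set_eqI iffI)
  fix p assume p: "p \<in> level R"
  then have "(snd p / R)\<^sup>2 + (q (fst p) / R)\<^sup>2 = 1"
    using assms by (simp add: level_def power_divide flip: add_divide_distrib)
  then obtain t where t: "0 \<le> t" "t < 2 * pi" "snd p / R = cos t" "q (fst p) / R = sin t"
    using sincos_total_2pi by blast
  then have "q (fst p) = R * sin t" "snd p = R * cos t" using assms by (auto simp: field_simps)
  moreover from this have "q_inv (R * sin t) = fst p" using q_inv_q[of "fst p"] p by (simp add: level_def)
  ultimately have "p = point R t" by (simp add: point_def prod_eq_iff)
  then show "p \<in> point R ` {0..<2 * pi}" using t by auto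
next
  fix p assume "p \<in> point R ` {0..<2 * pi}"
  then obtain t where "p = point R t" by auto
  moreover have "(R * cos t)\<^sup>2 + (R * sin t)\<^sup>2 = R\<^sup>2"
    by (simp add: power_mult_distrib flip: distrib_left)
  ultimately show "p \<in> level R"
    using R_sin_less[OF assms, of t] by (simp add: level_def point_def q_inv_pos q_q_inv)
qed

lemma point_eq_iff:
  assumes "0 < R" "R < \<rho>"
  shows "point R a = point R b \<longleftrightarrow> (\<exists>k::int. a = b + 2 * pi * k)"
proof -
  have "q_inv (R * sin a) = q_inv (R * sin b) \<longleftrightarrow> sin a = sin b"
    using q_q_inv[OF R_sin_less[OF assms]] assms(1) by (metis mult_left_cancel less_irrefl)
  then have "point R a = point R b \<longleftrightarrow> sin a = sin b \<and> cos a = cos b"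
    using assms by (simp add: point_def)
  then show ?thesis by (simp only: sin_cos_eq_iff)
qed

text \<open>
  The rate of change of the angle along the flow, as a function of the angle.
\<close>
definition angular_speed :: "real \<Rightarrow> real \<Rightarrow> real" where
  "angular_speed R \<theta> = q' (q_inv (R * sin \<theta>))"

lemma q_inv_continuous_on: "continuous_on {- \<rho><..<\<rho>} q_inv"
  using q_inv_isCont by (intro continuous_at_imp_continuous_on) auto

lemma comp_q_inv_continuous_on:
  assumes "continuous_on {0<..} f"
  shows "continuous_on {- \<rho><..<\<rho>} (\<lambda>s. f (q_inv s))"
  by (rule continuous_on_compose2[OF assms q_inv_continuous_on]) (auto intro!: q_inv_pos)

lemma comp_sin_continuous_on:
  assumes "0 < R" "R < \<rho>" "continuous_on {- \<rho><..<\<rho>} f"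
  shows "continuous_on UNIV (\<lambda>\<theta>. f (R * sin \<theta>))"
  by (rule continuous_on_compose2[OF assms(3)])
     (use R_sin_less[OF assms(1,2)] in \<open>auto intro!: continuous_intros simp: abs_less_iff minus_less_iff\<close>)

text \<open>
  The complex number \<open>y + i * q u\<close> satisfies a linear equation with the purely imaginary coefficient
  \<open>i * q' u\<close>; it is therefore its initial value rotated by an antiderivative of \<open>q' u\<close>. Injectivity on
  one period excludes more than one turn.
\<close>
lemma angle_of_trajectory:
  assumes R: "0 < R" "R < \<rho>" and tr: "closed_trajectory n (level R) \<gamma> T"
  obtains \<theta> where "\<And>t. (\<theta> has_real_derivative angular_speed R (\<theta> t)) (at t)"
    "\<And>t. \<gamma> t = point R (\<theta> t)" "\<theta> T = \<theta> 0 + 2 * pi"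
proof -
  have T: "0 < T" and ode: "\<And>t. (\<gamma> has_vector_derivative vector_field n (\<gamma> t)) (at t)"
    and per: "\<And>t. \<gamma> (t + T) = \<gamma> t" and inj: "inj_on \<gamma> {0..<T}"
    and img: "\<gamma> ` {0..<T} = level R"
    using tr by (auto simp: closed_trajectory_def)
  \<comment> \<open>The image is prescribed on one period only; reduce \<open>t\<close> modulo \<open>T\<close>.\<close>
  have level: "\<gamma> t \<in> level R" for t
  proof -
    have nat: "\<gamma> (t + real k * T) = \<gamma> t" for t k
    proof (induction k)
      case (Suc k)
      then show ?case using per[of "t + real k * T"] by (simp add: algebra_simps)
    qed simp
    define m where "m = \<lfloor>t / T\<rfloor>"
    define r where "r = t - m * T"
    have "m \<le> t / T" "t / T < m + 1" by (auto simp: m_def)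
    then have "m * T \<le> t" "t < (m + 1) * T" using T by (auto simp: field_simps)
    then have r: "r \<in> {0..<T}" by (auto simp: r_def algebra_simps)
    have "\<gamma> t = \<gamma> r"
    proof (cases "0 \<le> m")
      case True
      then show ?thesis using nat[of r "nat m"] by (simp add: r_def)
    next
      case False
      then show ?thesis using nat[of t "nat (- m)"] by (simp add: r_def)
    qed
    then show ?thesis using img r by (metis image_eqI)
  qed
  define u y where "u = (\<lambda>t. fst (\<gamma> t))" and "y = (\<lambda>t. snd (\<gamma> t))"
  have gam: "\<gamma> t = (u t, y t)" for t by (simp add: u_def y_def)
  have u_pos: "0 < u t" for t using level[of t] by (simp add: level_def u_def)
  have energy: "(y t)\<^sup>2 + (q (u t))\<^sup>2 = R\<^sup>2" for t
    using level[of t] by (simp add: level_def u_def y_def)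
  have vd: "(\<gamma> has_vector_derivative (y t, - (q (u t) * q' (u t)))) (at t)" for t
    using ode[of t] field[OF u_pos[of t]] by (simp add: gam)
  have du: "(u has_real_derivative y t) (at t)" for t
    using bounded_linear.has_vector_derivative[OF bounded_linear_fst vd[of t]]
    by (simp add: u_def has_real_derivative_iff_has_vector_derivative)
  have dy: "(y has_real_derivative - (q (u t) * q' (u t))) (at t)" for t
    using bounded_linear.has_vector_derivative[OF bounded_linear_snd vd[of t]]
    by (simp add: y_def has_real_derivative_iff_has_vector_derivative)
  have dq: "((\<lambda>t. q (u t)) has_real_derivative q' (u t) * y t) (at t)" for t
    by (rule DERIV_chain2[OF q_deriv[OF u_pos] du])
  have "continuous_on UNIV u"
    using du by (intro continuous_at_imp_continuous_on) (auto intro: DERIV_isCont)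
  then have "continuous_on UNIV (\<lambda>t. q' (u t))"
    by (rule continuous_on_compose2[OF q'_cont]) (auto intro: u_pos)
  then obtain A where A: "\<And>t. (A has_real_derivative q' (u t)) (at t)"
    using continuous_antiderivative_UNIV by blast
  obtain a where a: "\<gamma> 0 = point R a"
    using level[of 0] unfolding level_eq[OF R] by blast
  define \<theta> where "\<theta> = (\<lambda>t. a + A t - A 0)"
  have d\<theta>: "(\<theta> has_real_derivative q' (u t)) (at t)" for t
    unfolding \<theta>_def by (auto intro!: derivative_eq_intros A)
  have point: "\<gamma> t = point R (\<theta> t)" for t
  proof -
    \<comment> \<open>\<open>B\<close> and \<open>E\<close> are the components of \<open>(y, q u)\<close> in the frame rotating with \<open>\<theta>\<close>: both are constant.\<close>
    define B where "B = (\<lambda>t. y t * cos (\<theta> t) + q (u t) * sin (\<theta> t))"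
    define E where "E = (\<lambda>t. y t * sin (\<theta> t) - q (u t) * cos (\<theta> t))"
    have "(B has_real_derivative 0) (at s)" "(E has_real_derivative 0) (at s)" for s
      unfolding B_def E_def
      by (auto intro!: derivative_eq_intros d\<theta> dy dq simp: algebra_simps)
    then have "B t = B 0" "E t = E 0" using DERIV_isconst_all by blast+
    moreover have "y 0 = R * cos a" "q (u 0) = R * sin a"
      using a q_q_inv[OF R_sin_less[OF R, of a]] by (auto simp: gam point_def)
    ultimately have BE: "B t = R" "E t = 0"
      by (auto simp: B_def E_def \<theta>_def algebra_simps simp flip: power2_eq_square distrib_left)
    have "y t = B t * cos (\<theta> t) + E t * sin (\<theta> t)" "q (u t) = B t * sin (\<theta> t) - E t * cos (\<theta> t)"
      using sin_cos_squared_add[of "\<theta> t"] unfolding B_def E_def by algebra+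
    then have "y t = R * cos (\<theta> t)" "q (u t) = R * sin (\<theta> t)" by (simp_all add: BE)
    then show ?thesis using q_inv_q[OF u_pos[of t]] by (simp add: point_def gam)
  qed
  have inc: "\<theta> s < \<theta> t" if "s < t" for s t
    by (rule DERIV_pos_imp_increasing[OF that]) (use d\<theta> q'_pos u_pos in blast)
  have "point R (\<theta> T) = point R (\<theta> 0)" using per[of 0] by (simp flip: point)
  then obtain k :: int where k: "\<theta> T = \<theta> 0 + 2 * pi * k" using point_eq_iff[OF R] by blast
  have "0 < k" using inc[OF T] k by (simp add: zero_less_mult_iff)
  moreover have "\<not> 1 < k"
  proof
    assume "1 < k"
    then have "2 * pi * 1 < 2 * pi * k" by (intro mult_strict_left_mono) auto
    then have "\<theta> 0 + 2 * pi < \<theta> T" by (simp add: k)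
    moreover have "continuous_on {0..T} \<theta>"
      using d\<theta> by (intro continuous_at_imp_continuous_on) (auto intro: DERIV_isCont)
    ultimately obtain t where t: "0 \<le> t" "t \<le> T" "\<theta> t = \<theta> 0 + 2 * pi"
      using IVT'[of \<theta> 0 "\<theta> 0 + 2 * pi" T] T by auto
    then have "\<gamma> t = \<gamma> 0"
      using point_eq_iff[OF R, of "\<theta> t" "\<theta> 0"] by (auto simp: point intro!: exI[of _ 1])
    moreover have "t \<noteq> 0" "t \<noteq> T" using t \<open>\<theta> 0 + 2 * pi < \<theta> T\<close> by auto
    ultimately show False using inj t T by (auto simp: inj_on_def)
  qed
  ultimately have "\<theta> T = \<theta> 0 + 2 * pi" using k by (simp add: less_le)
  moreover have "u t = q_inv (R * sin (\<theta> t))" for t using point[of t] by (simp add: gam point_def)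
  ultimately show ?thesis
    using d\<theta> point by (intro that[of \<theta>]) (simp_all only: angular_speed_def)
qed

lemma angular_speed_pos: "0 < R \<Longrightarrow> R < \<rho> \<Longrightarrow> 0 < angular_speed R \<theta>"
  unfolding angular_speed_def by (intro q'_pos q_inv_pos R_sin_less)

text \<open>
  Time as a function of the angle is an antiderivative of \<open>1 / angular_speed\<close>. The angular speed is
  bounded on the circle, so this function maps the line onto itself, and its inverse gives the angle
  as a function of time.
\<close>
lemma closed_trajectory_exists:
  assumes R: "0 < R" "R < \<rho>"
  shows "\<exists>\<gamma> T. closed_trajectory n (level R) \<gamma> T"
proof -
  have cont: "continuous_on {- \<rho><..<\<rho>} (\<lambda>s. q' (q_inv s))"
    by (rule comp_q_inv_continuous_on[OF q'_cont])
  have "continuous_on UNIV (angular_speed R)"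
    using comp_sin_continuous_on[OF R cont] by (simp add: angular_speed_def[abs_def])
  then have "continuous_on UNIV (\<lambda>\<theta>. 1 / angular_speed R \<theta>)"
    using angular_speed_pos[OF R] by (intro continuous_intros) (auto simp: less_imp_neq[THEN not_sym])
  then obtain \<tau>0 where "\<And>\<theta>. (\<tau>0 has_real_derivative 1 / angular_speed R \<theta>) (at \<theta>)"
    using continuous_antiderivative_UNIV by blast
  moreover define \<tau> where "\<tau> = (\<lambda>\<theta>. \<tau>0 \<theta> - \<tau>0 0)"
  ultimately have d\<tau>: "\<And>\<theta>. (\<tau> has_real_derivative 1 / angular_speed R \<theta>) (at \<theta>)"
    by (auto intro!: derivative_eq_intros)
  have \<tau>0: "\<tau> 0 = 0" by (simp add: \<tau>_def)
  have \<tau>_cont: "isCont \<tau> \<theta>" for \<theta> by (rule DERIV_isCont[OF d\<tau>])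
  have \<tau>_mono: "\<tau> a < \<tau> b" if "a < b" for a b
    by (rule DERIV_pos_imp_increasing[OF that]) (use d\<tau> angular_speed_pos[OF R] in \<open>auto intro!: exI\<close>)
  have \<tau>_less_iff: "\<tau> a < \<tau> b \<longleftrightarrow> a < b" for a b
    using \<tau>_mono[of a b] \<tau>_mono[of b a] by (cases a b rule: linorder_cases) auto
  have "continuous_on {- R..R} (\<lambda>s. q' (q_inv s))"
    by (rule continuous_on_subset[OF cont]) (use R in auto)
  then have "bounded ((\<lambda>s. q' (q_inv s)) ` {- R..R})"
    by (intro compact_imp_bounded compact_continuous_image) auto
  then obtain K where K: "0 < K" "\<And>s. s \<in> {- R..R} \<Longrightarrow> \<bar>q' (q_inv s)\<bar> \<le> K"
    unfolding bounded_pos by auto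
  have angular_speed_le: "angular_speed R \<theta> \<le> K" for \<theta>
  proof -
    have "\<bar>R * sin \<theta>\<bar> = R * \<bar>sin \<theta>\<bar>" using R by (simp add: abs_mult)
    also have "\<dots> \<le> R" using R by (intro mult_left_le abs_sin_le_one) simp
    finally show ?thesis using K(2)[of "R * sin \<theta>"] by (auto simp: angular_speed_def abs_le_iff)
  qed
  \<comment> \<open>A turn by \<open>b - a\<close> at speed at most \<open>K\<close> takes time at least \<open>(b - a) / K\<close>.\<close>
  have lower: "b - a \<le> K * (\<tau> b - \<tau> a)" if "a \<le> b" for a b
  proof -
    have "K * \<tau> a - a \<le> K * \<tau> b - b"
    proof (rule DERIV_nonneg_imp_nondecreasing[OF that])
      fix x
      have "((\<lambda>x. K * \<tau> x - x) has_real_derivative K * (1 / angular_speed R x) - 1) (at x)"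
        by (auto intro!: derivative_eq_intros d\<tau>)
      moreover have "0 \<le> K * (1 / angular_speed R x) - 1"
        using angular_speed_le[of x] angular_speed_pos[OF R, of x] by (simp add: field_simps)
      ultimately show "\<exists>y. ((\<lambda>x. K * \<tau> x - x) has_real_derivative y) (at x) \<and> 0 \<le> y" by blast
    qed
    then show ?thesis by (simp add: algebra_simps)
  qed
  have "\<exists>\<theta>. \<tau> \<theta> = t" for t
  proof -
    have "K * \<bar>t\<bar> \<le> K * \<tau> (K * \<bar>t\<bar>)" "K * \<tau> (- (K * \<bar>t\<bar>)) \<le> K * (- \<bar>t\<bar>)"
      using lower[of 0 "K * \<bar>t\<bar>"] lower[of "- (K * \<bar>t\<bar>)" 0] K(1) by (auto simp: \<tau>0)
    then have "\<bar>t\<bar> \<le> \<tau> (K * \<bar>t\<bar>)" "\<tau> (- (K * \<bar>t\<bar>)) \<le> - \<bar>t\<bar>"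
      using K(1) by (simp_all only: mult_le_cancel_left_pos)
    then have "\<tau> (- (K * \<bar>t\<bar>)) \<le> t" "t \<le> \<tau> (K * \<bar>t\<bar>)" by linarith+
    moreover have "- (K * \<bar>t\<bar>) \<le> K * \<bar>t\<bar>" using K(1) by simp
    ultimately show ?thesis
      using IVT[of \<tau> "- (K * \<bar>t\<bar>)" t "K * \<bar>t\<bar>"] \<tau>_cont by blast
  qed
  then obtain \<theta> where \<tau>_\<theta>: "\<And>t. \<tau> (\<theta> t) = t" by metis
  have \<theta>_\<tau>: "\<theta> (\<tau> a) = a" for a
    using \<tau>_\<theta>[of "\<tau> a"] \<tau>_mono[of a "\<theta> (\<tau> a)"] \<tau>_mono[of "\<theta> (\<tau> a)" a]
    by (cases a "\<theta> (\<tau> a)" rule: linorder_cases) auto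
  have \<theta>_less_iff: "\<theta> s < \<theta> t \<longleftrightarrow> s < t" for s t
    using \<tau>_less_iff[of "\<theta> s" "\<theta> t"] by (simp add: \<tau>_\<theta>)
  have \<theta>_cont: "isCont \<theta> t" for t
    using isCont_inverse_function2[where f = \<tau> and g = \<theta> and x = "\<theta> t" and a = "\<theta> t - 1" and b = "\<theta> t + 1"]
      \<theta>_\<tau> \<tau>_cont by (simp add: \<tau>_\<theta>)
  have d\<theta>: "(\<theta> has_real_derivative angular_speed R (\<theta> t)) (at t)" for t
    using DERIV_inverse_function[OF d\<tau>, of \<theta> t "t - 1" "t + 1"] angular_speed_pos[OF R, of "\<theta> t"] \<theta>_cont \<tau>_\<theta>
    by simp
  define T where "T = \<tau> (2 * pi)"
  have per: "\<tau> (a + 2 * pi) = \<tau> a + T" for a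
  proof -
    have "((\<lambda>a. \<tau> (a + 2 * pi) - \<tau> a) has_real_derivative 0) (at x)" for x
    proof -
      have "((\<lambda>a. \<tau> (a + 2 * pi)) has_real_derivative 1 / angular_speed R (x + 2 * pi)) (at x)"
        using d\<tau>[of "x + 2 * pi"] DERIV_at_within_shift[of \<tau> _ "2 * pi" x UNIV]
        by (simp add: add.commute)
      then show ?thesis
        using DERIV_diff[OF _ d\<tau>[of x]] by (fastforce simp: angular_speed_def)
    qed
    then have "\<tau> (a + 2 * pi) - \<tau> a = \<tau> (0 + 2 * pi) - \<tau> 0"
      using DERIV_isconst_all[of "\<lambda>a. \<tau> (a + 2 * pi) - \<tau> a" a 0] by blast
    then show ?thesis by (simp add: T_def \<tau>0)
  qed
  have \<theta>_per: "\<theta> (t + T) = \<theta> t + 2 * pi" for t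
    using per[of "\<theta> t"] \<theta>_\<tau>[of "\<theta> t + 2 * pi"] by (simp add: \<tau>_\<theta>)
  have "0 < T" using \<tau>_mono[of 0 "2 * pi"] by (simp add: T_def \<tau>0)
  have \<theta>0: "\<theta> 0 = 0" "\<theta> T = 2 * pi" using \<theta>_\<tau>[of 0] \<theta>_\<tau>[of "2 * pi"] by (simp_all add: \<tau>0 T_def)
  have \<theta>_le_iff: "\<theta> s \<le> \<theta> t \<longleftrightarrow> s \<le> t" for s t
    using \<theta>_less_iff[of t s] by (simp add: not_less[symmetric])
  have \<theta>_in: "\<theta> t \<in> {0..<2 * pi} \<longleftrightarrow> t \<in> {0..<T}" for t
    using \<theta>_le_iff[of 0 t] \<theta>_less_iff[of t T] by (simp add: \<theta>0)
  define \<gamma> where "\<gamma> = (\<lambda>t. point R (\<theta> t))"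
  have "(\<gamma> has_vector_derivative vector_field n (\<gamma> t)) (at t)" for t
  proof -
    define s where "s = R * sin (\<theta> t)"
    have s: "\<bar>s\<bar> < \<rho>" unfolding s_def by (rule R_sin_less[OF R])
    have "((\<lambda>t. R * sin (\<theta> t)) has_real_derivative R * cos (\<theta> t) * q' (q_inv s)) (at t)"
      by (auto intro!: derivative_eq_intros d\<theta> simp: angular_speed_def s_def)
    then have "((\<lambda>t. q_inv (R * sin (\<theta> t))) has_real_derivative
        inverse (q' (q_inv s)) * (R * cos (\<theta> t) * q' (q_inv s))) (at t)"
      using q_inv_deriv[OF s] unfolding s_def by (rule DERIV_chain2[rotated])
    moreover have "inverse (q' (q_inv s)) * (R * cos (\<theta> t) * q' (q_inv s)) = R * cos (\<theta> t)"
      using q'_pos[OF q_inv_pos[OF s]] by (simp add: field_simps)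
    ultimately have "((\<lambda>t. q_inv (R * sin (\<theta> t))) has_real_derivative R * cos (\<theta> t)) (at t)"
      by metis
    moreover have "((\<lambda>t. R * cos (\<theta> t)) has_real_derivative - (s * q' (q_inv s))) (at t)"
      by (auto intro!: derivative_eq_intros d\<theta> simp: angular_speed_def s_def)
    moreover have "vector_field n (\<gamma> t) = (R * cos (\<theta> t), - (s * q' (q_inv s)))"
      using field[OF q_inv_pos[OF s]] by (simp add: \<gamma>_def point_def q_q_inv[OF s] flip: s_def)
    ultimately show ?thesis
      unfolding \<gamma>_def point_def has_real_derivative_iff_has_vector_derivative
      by (auto intro: has_vector_derivative_Pair)
  qed
  moreover have "\<gamma> (t + T) = \<gamma> t" for t
    by (simp add: \<gamma>_def \<theta>_per point_def)
  moreover have "inj_on \<gamma> {0..<T}"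
  proof (rule inj_onI)
    fix s t assume st: "s \<in> {0..<T}" "t \<in> {0..<T}" "\<gamma> s = \<gamma> t"
    then obtain k :: int where k: "\<theta> s = \<theta> t + 2 * pi * k"
      unfolding \<gamma>_def point_eq_iff[OF R] by blast
    have "\<bar>2 * pi * k\<bar> < 2 * pi * 1"
      using st k \<theta>_in[of s] \<theta>_in[of t] by auto
    then have "\<bar>real_of_int k\<bar> < 1" by (simp add: abs_mult)
    then have "\<theta> s = \<theta> t" using k by simp
    then show "s = t" by (metis \<tau>_\<theta>)
  qed
  moreover have "\<gamma> ` {0..<T} = level R"
  proof -
    have "\<theta> ` {0..<T} = {0..<2 * pi}"
      using \<theta>_in \<theta>_\<tau> by (auto simp: image_iff) (metis atLeastLessThan_iff)
    then show ?thesis unfolding level_eq[OF R] by (simp add: \<gamma>_def flip: image_image)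
  qed
  ultimately show ?thesis using \<open>0 < T\<close> unfolding closed_trajectory_def by blast
qed

text \<open>
  The two points at which the potential energy is \<open>s\<^sup>2 / 2\<close> contribute together.
\<close>
definition folded :: "(real \<Rightarrow> real) \<Rightarrow> real \<Rightarrow> real" where
  "folded \<phi> s = \<phi> (q_inv s) / q' (q_inv s) + \<phi> (q_inv (- s)) / q' (q_inv (- s))"

text \<open>
  Substitution of \<open>s = R * sin x\<close>. On the half turn where \<open>cos x\<close> is negative, \<open>s\<close> runs backwards and the
  square root is \<open>- R * cos x\<close>, so the two half turns contribute equally; this accounts for the factor 2.
\<close>
lemma period_integral:
  assumes R: "0 < R" "R < \<rho>" and \<phi>: "continuous_on {0<..} \<phi>"
    and W: "\<And>x. (W has_real_derivative \<phi> (q_inv (R * sin x)) / angular_speed R x * (R * cos x)\<^sup>2) (at x)"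
  shows "W (x + 2 * pi) - W x = 2 * integral {0..R} (\<lambda>s. folded \<phi> s * sqrt (R\<^sup>2 - s\<^sup>2))"
proof -
  define N where "N = (\<lambda>s. \<phi> (q_inv s) / q' (q_inv s))"
  have N_cont: "continuous_on {- \<rho><..<\<rho>} N"
    unfolding N_def
    by (intro continuous_intros comp_q_inv_continuous_on \<phi> q'_cont)
       (auto intro!: less_imp_neq[THEN not_sym] q'_pos q_inv_pos)
  then have "continuous_on {- \<rho><..<\<rho>} (\<lambda>s. N s * sqrt (R\<^sup>2 - s\<^sup>2))"
    by (intro continuous_intros)
  then obtain V where V: "\<And>s. s \<in> {- \<rho><..<\<rho>} \<Longrightarrow> (V has_real_derivative N s * sqrt (R\<^sup>2 - s\<^sup>2)) (at s)"
    using continuous_antiderivative[of "- \<rho>" "\<rho>"] R by auto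
  have V: "(V has_real_derivative N s * sqrt (R\<^sup>2 - s\<^sup>2)) (at s)" if "\<bar>s\<bar> < \<rho>" for s
    using that by (intro V) (auto simp: abs_less_iff)
  have VR: "((\<lambda>x. V (R * sin x)) has_real_derivative N (R * sin x) * \<bar>R * cos x\<bar> * (R * cos x)) (at x)" for x
  proof -
    have "R\<^sup>2 - (R * sin x)\<^sup>2 = (R * cos x)\<^sup>2"
      using sin_cos_squared_add[of x] by algebra
    then have "sqrt (R\<^sup>2 - (R * sin x)\<^sup>2) = \<bar>R * cos x\<bar>" by simp
    moreover have "((\<lambda>x. R * sin x) has_real_derivative R * cos x) (at x)"
      by (auto intro!: derivative_eq_intros)
    ultimately show ?thesis
      using DERIV_chain2[of V _ "\<lambda>x. R * sin x" x, OF V[OF R_sin_less[OF R, of x]]] by metis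
  qed
  have W': "(W has_real_derivative N (R * sin x) * (R * cos x)\<^sup>2) (at x)" for x
    using W[of x] by (simp add: N_def angular_speed_def)
  have "W (pi / 2) - V (R * sin (pi / 2)) = W (- (pi / 2)) - V (R * sin (- (pi / 2)))"
  proof (rule DERIV_isconst2[where f = "\<lambda>x. W x - V (R * sin x)" and b = "pi / 2"])
    show "continuous_on {- (pi / 2)..pi / 2} (\<lambda>x. W x - V (R * sin x))"
      using W' VR by (intro continuous_on_diff continuous_at_imp_continuous_on) (auto intro: DERIV_isCont)
    fix x assume "- (pi / 2) < x" "x < pi / 2"
    then have "0 \<le> R * cos x" using R by (intro mult_nonneg_nonneg cos_ge_zero) auto
    then show "((\<lambda>x. W x - V (R * sin x)) has_real_derivative 0) (at x)"
      using DERIV_diff[OF W'[of x] VR[of x]] by (simp add: power2_eq_square algebra_simps)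
  qed (auto intro: less_trans[of _ 0])
  moreover have "W (3 * pi / 2) + V (R * sin (3 * pi / 2)) = W (pi / 2) + V (R * sin (pi / 2))"
  proof (rule DERIV_isconst2[where f = "\<lambda>x. W x + V (R * sin x)" and b = "3 * pi / 2"])
    show "continuous_on {pi / 2..3 * pi / 2} (\<lambda>x. W x + V (R * sin x))"
      using W' VR by (intro continuous_on_add continuous_at_imp_continuous_on) (auto intro: DERIV_isCont)
    fix x assume "pi / 2 < x" "x < 3 * pi / 2"
    then have "0 \<le> cos (x - pi)" by (intro cos_ge_zero) auto
    then have "R * cos x \<le> 0" using R by (simp add: mult_nonneg_nonpos)
    then show "((\<lambda>x. W x + V (R * sin x)) has_real_derivative 0) (at x)"
      using DERIV_add[OF W'[of x] VR[of x]] by (simp add: power2_eq_square algebra_simps)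
  qed auto
  moreover have "sin (3 * pi / 2) = - 1" using sin_3over2_pi by (simp add: mult.commute)
  ultimately have "W (- (pi / 2) + 2 * pi) - W (- (pi / 2)) = 2 * (V R - V (- R))"
    by (simp add: field_simps)
  moreover have "W (x + 2 * pi) - W x = W (- (pi / 2) + 2 * pi) - W (- (pi / 2))"
  proof -
    have "((\<lambda>x. W (x + 2 * pi) - W x) has_real_derivative 0) (at x)" for x
    proof -
      have "((\<lambda>x. W (x + 2 * pi)) has_real_derivative N (R * sin x) * (R * cos x)\<^sup>2) (at x)"
        using W'[of "x + 2 * pi"] DERIV_at_within_shift[of W _ "2 * pi" x UNIV]
        by (simp add: add.commute)
      from DERIV_diff[OF this W'[of x]] show ?thesis by simp
    qed
    then show ?thesis
      using DERIV_isconst_all[of "\<lambda>x. W (x + 2 * pi) - W x" x "- (pi / 2)"] by blast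
  qed
  moreover have "((\<lambda>s. folded \<phi> s * sqrt (R\<^sup>2 - s\<^sup>2)) has_integral (V R - V (- R)) - (V 0 - V (- 0))) {0..R}"
  proof (rule fundamental_theorem_of_calculus)
    fix s assume s: "s \<in> {0..R}"
    have "((\<lambda>s. V (- s)) has_real_derivative (N (- s) * sqrt (R\<^sup>2 - (- s)\<^sup>2)) * - 1) (at s)"
      using s R by (intro DERIV_chain2[OF V]) (auto intro!: derivative_eq_intros)
    from DERIV_diff[OF V[of s] this]
    have "((\<lambda>s. V s - V (- s)) has_real_derivative folded \<phi> s * sqrt (R\<^sup>2 - s\<^sup>2)) (at s)"
      using s R by (simp add: folded_def N_def algebra_simps)
    then show "((\<lambda>s. V s - V (- s)) has_vector_derivative folded \<phi> s * sqrt (R\<^sup>2 - s\<^sup>2)) (at s within {0..R})"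
      by (simp add: has_vector_derivative_at_within has_real_derivative_iff_has_vector_derivative)
  qed (use R in simp)
  ultimately show ?thesis by (simp add: integral_unique)
qed

lemma trajectory_integral:
  assumes R: "0 < R" "R < \<rho>" and \<phi>: "continuous_on {0<..} \<phi>"
    and tr: "closed_trajectory n (level R) \<gamma> T"
  shows "((\<lambda>t. (\<lambda>(u, y). \<phi> u * y) (\<gamma> t) * deriv (\<lambda>s. fst (\<gamma> s)) t) has_integral
     2 * integral {0..R} (\<lambda>s. folded \<phi> s * sqrt (R\<^sup>2 - s\<^sup>2))) {0..T}"
proof -
  obtain \<theta> where d\<theta>: "\<And>t. (\<theta> has_real_derivative angular_speed R (\<theta> t)) (at t)"
    and point: "\<And>t. \<gamma> t = point R (\<theta> t)" and \<theta>T: "\<theta> T = \<theta> 0 + 2 * pi"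
    using angle_of_trajectory[OF R tr] by blast
  have "0 < T" using tr by (simp add: closed_trajectory_def)
  have deriv: "deriv (\<lambda>s. fst (\<gamma> s)) t = R * cos (\<theta> t)" for t
  proof -
    have "(\<gamma> has_vector_derivative vector_field n (\<gamma> t)) (at t)"
      using tr by (simp add: closed_trajectory_def)
    from bounded_linear.has_vector_derivative[OF bounded_linear_fst this]
    have "((\<lambda>s. fst (\<gamma> s)) has_real_derivative fst (vector_field n (\<gamma> t))) (at t)"
      by (simp add: has_real_derivative_iff_has_vector_derivative)
    moreover have "fst (vector_field n (\<gamma> t)) = R * cos (\<theta> t)"
      by (simp add: vector_field_def point point_def)
    ultimately show ?thesis by (simp add: DERIV_imp_deriv)
  qed
  have "continuous_on UNIV (\<lambda>x. \<phi> (q_inv (R * sin x)) / angular_speed R x * (R * cos x)\<^sup>2)"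
    unfolding angular_speed_def using less_imp_neq[OF q'_pos[OF q_inv_pos[OF R_sin_less[OF R]]], THEN not_sym]
    by (intro continuous_intros comp_sin_continuous_on[OF R] comp_q_inv_continuous_on \<phi> q'_cont) simp
  then obtain W where
    W: "\<And>x. (W has_real_derivative \<phi> (q_inv (R * sin x)) / angular_speed R x * (R * cos x)\<^sup>2) (at x)"
    using continuous_antiderivative_UNIV by blast
  have "((\<lambda>t. (\<lambda>(u, y). \<phi> u * y) (\<gamma> t) * deriv (\<lambda>s. fst (\<gamma> s)) t) has_integral
    W (\<theta> T) - W (\<theta> 0)) {0..T}"
  proof (rule fundamental_theorem_of_calculus)
    fix t
    have "((\<lambda>t. W (\<theta> t)) has_real_derivative
        \<phi> (q_inv (R * sin (\<theta> t))) / angular_speed R (\<theta> t) * (R * cos (\<theta> t))\<^sup>2 * angular_speed R (\<theta> t)) (at t)"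
      by (rule DERIV_chain2[OF W d\<theta>])
    moreover have "\<phi> (q_inv (R * sin (\<theta> t))) / angular_speed R (\<theta> t) * (R * cos (\<theta> t))\<^sup>2 * angular_speed R (\<theta> t)
        = (\<lambda>(u, y). \<phi> u * y) (\<gamma> t) * deriv (\<lambda>s. fst (\<gamma> s)) t"
      unfolding deriv using angular_speed_pos[OF R, of "\<theta> t"]
      by (simp add: point point_def power2_eq_square)
    ultimately show "((\<lambda>t. W (\<theta> t)) has_vector_derivative
       (\<lambda>(u, y). \<phi> u * y) (\<gamma> t) * deriv (\<lambda>s. fst (\<gamma> s)) t) (at t within {0..T})"
      by (simp only: has_vector_derivative_at_within has_real_derivative_iff_has_vector_derivative)
  qed (use \<open>0 < T\<close> in simp)
  then show ?thesis
    using period_integral[OF R \<phi> W, of "\<theta> 0"] by (simp add: \<theta>T)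
qed

lemma line_integral_du_level:
  assumes "0 < R" "R < \<rho>" "continuous_on {0<..} \<phi>"
  shows "line_integral_du n (level R) (\<lambda>(u, y). \<phi> u * y) =
    2 * integral {0..R} (\<lambda>s. folded \<phi> s * sqrt (R\<^sup>2 - s\<^sup>2))"
  unfolding line_integral_du_def
proof (rule the_equality)
  show "\<exists>\<gamma> T. closed_trajectory n (level R) \<gamma> T \<and>
      ((\<lambda>t. (\<lambda>(u, y). \<phi> u * y) (\<gamma> t) * deriv (\<lambda>s. fst (\<gamma> s)) t) has_integral
        2 * integral {0..R} (\<lambda>s. folded \<phi> s * sqrt (R\<^sup>2 - s\<^sup>2))) {0..T}"
    using closed_trajectory_exists[OF assms(1,2)] trajectory_integral[OF assms] by blast
qed (use trajectory_integral[OF assms] has_integral_unique in blast)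

section \<open>Monotonicity of the folded density quotient\<close>

lemma restoring_force: "0 < u \<Longrightarrow> q u * q' u = u * (u ^ n / real (n + 1) - 1)"
  using field[of u 0] by (simp add: vector_field_def algebra_simps)

lemma folded_continuous_on:
  assumes "R < \<rho>" "continuous_on {0<..} \<phi>"
  shows "continuous_on {0..R} (folded \<phi>)"
proof -
  have *: "continuous_on {- \<rho><..<\<rho>} (\<lambda>s. \<phi> (q_inv s) / q' (q_inv s))"
    by (intro continuous_intros comp_q_inv_continuous_on assms q'_cont)
       (auto intro!: less_imp_neq[THEN not_sym] q'_pos q_inv_pos)
  have "continuous_on {0..R} (\<lambda>s. \<phi> (q_inv (- s)) / q' (q_inv (- s)))"
    by (rule continuous_on_compose2[OF *]) (use assms in \<open>auto intro!: continuous_intros\<close>)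
  moreover have "continuous_on {0..R} (\<lambda>s. \<phi> (q_inv s) / q' (q_inv s))"
    by (rule continuous_on_subset[OF *]) (use assms in auto)
  ultimately show ?thesis unfolding folded_def[abs_def] by (rule continuous_on_add[rotated])
qed

lemma folded_one_pos: "\<bar>s\<bar> < \<rho> \<Longrightarrow> 0 < folded (\<lambda>u. 1) s"
  unfolding folded_def by (intro add_pos_pos divide_pos_pos q'_pos q_inv_pos) auto

text \<open>
  The reciprocal of the relative amount by which the quotient of the folded densities stays below
  its value \<open>n + 1\<close> at the center. It is written as a sum of products of factors each of which
  decreases in \<open>s\<close>.
\<close>
definition recip_defect :: "real \<Rightarrow> real" where
  "recip_defect s = q_inv (- s) / (q_inv s - q_inv (- s)) * (1 / (q_inv s ^ n / real (n + 1) - 1))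
       + q_inv s / (q_inv s - q_inv (- s)) * (1 / (1 - q_inv (- s) ^ n / real (n + 1)))"

text \<open>
  Evaluating \<open>q * q'\<close> where \<open>q\<close> is \<open>s\<close> or \<open>- s\<close> turns \<open>1 / q'\<close> into an algebraic expression in the two points.
\<close>
lemma restoring_force_at_q_inv:
  assumes "0 < s" "s < \<rho>"
  shows "s * q' (q_inv s) = q_inv s * (q_inv s ^ n / real (n + 1) - 1)"
    and "s * q' (q_inv (- s)) = q_inv (- s) * (1 - q_inv (- s) ^ n / real (n + 1))"
    and "0 < q_inv s ^ n / real (n + 1) - 1" "0 < 1 - q_inv (- s) ^ n / real (n + 1)"
proof -
  have s: "\<bar>s\<bar> < \<rho>" "\<bar>- s\<bar> < \<rho>" using assms by auto
  show 1: "s * q' (q_inv s) = q_inv s * (q_inv s ^ n / real (n + 1) - 1)"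
    using restoring_force[OF q_inv_pos[OF s(1)]] by (simp only: q_q_inv[OF s(1)])
  have "- s * q' (q_inv (- s)) = q_inv (- s) * (q_inv (- s) ^ n / real (n + 1) - 1)"
    using restoring_force[OF q_inv_pos[OF s(2)]] by (simp only: q_q_inv[OF s(2)])
  then show 2: "s * q' (q_inv (- s)) = q_inv (- s) * (1 - q_inv (- s) ^ n / real (n + 1))"
    by (simp add: algebra_simps)
  have "0 < s * q' (q_inv s)" "0 < s * q' (q_inv (- s))"
    using assms(1) q'_pos[OF q_inv_pos[OF s(1)]] q'_pos[OF q_inv_pos[OF s(2)]] by simp_all
  then show "0 < q_inv s ^ n / real (n + 1) - 1" "0 < 1 - q_inv (- s) ^ n / real (n + 1)"
    unfolding 1 2 zero_less_mult_iff using q_inv_pos[OF s(1)] q_inv_pos[OF s(2)] by auto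
qed

lemma recip_defect_pos:
  assumes "0 < s" "s < \<rho>"
  shows "0 < recip_defect s"
  using assms restoring_force_at_q_inv(3,4)[OF assms] q_inv_pos[of s] q_inv_pos[of "- s"] q_inv_strict_mono[of "- s" s]
  unfolding recip_defect_def by (intro add_pos_pos mult_pos_pos divide_pos_pos) auto

text \<open>
  The interval between the two points grows at both ends with \<open>s\<close>, and this makes each factor smaller.
\<close>
lemma recip_defect_strict_decreasing:
  assumes n: "1 \<le> n" and s: "0 < s" "s < t" "t < \<rho>"
  shows "recip_defect t < recip_defect s"
proof -
  have nested: "0 < q_inv (- t)" "q_inv (- t) < q_inv (- s)" "q_inv (- s) < q_inv s" "q_inv s < q_inv t"
    using s by (auto intro!: q_inv_pos q_inv_strict_mono)
  have prod: "q_inv (- t) * q_inv s < q_inv (- s) * q_inv t"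
    using nested by (intro mult_strict_mono) auto
  have "q_inv (- t) / (q_inv t - q_inv (- t)) < q_inv (- s) / (q_inv s - q_inv (- s))"
    "q_inv t / (q_inv t - q_inv (- t)) < q_inv s / (q_inv s - q_inv (- s))"
    using nested prod by (simp_all add: divide_simps algebra_simps)
  moreover have "q_inv s ^ n < q_inv t ^ n" "q_inv (- t) ^ n < q_inv (- s) ^ n"
    using n nested by (auto intro!: power_strict_mono)
  then have "1 / (q_inv t ^ n / real (n + 1) - 1) < 1 / (q_inv s ^ n / real (n + 1) - 1)"
    "1 / (1 - q_inv (- t) ^ n / real (n + 1)) < 1 / (1 - q_inv (- s) ^ n / real (n + 1))"
    using restoring_force_at_q_inv(3,4)[of s] s
    by (auto intro!: divide_strict_left_mono mult_pos_pos divide_strict_right_mono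
        simp: divide_strict_right_mono intro: less_trans)
  ultimately show ?thesis
    using restoring_force_at_q_inv(3,4)[of t] restoring_force_at_q_inv(3,4)[of s] s nested unfolding recip_defect_def
    by (intro add_strict_mono mult_strict_mono) auto
qed

text \<open>
  With \<open>a < b\<close> the two points, \<open>b ^ n = (n + 1) * (1 + \<beta>)\<close> and \<open>a ^ n = (n + 1) * (1 - \<alpha>)\<close>, while the force
  identity gives \<open>1 / q' b = s / (b * \<beta>)\<close> and \<open>1 / q' a = s / (a * \<alpha>)\<close>. Thus the density for \<open>u ^ n\<close> differs
  from \<open>n + 1\<close> times the density for 1 only by a multiple of \<open>1 / a - 1 / b\<close>.
\<close>
lemma folded_ratio:
  assumes "0 < s" "s < \<rho>"
  shows "folded (\<lambda>u. u ^ n) s / folded (\<lambda>u. 1) s = real (n + 1) * (1 - 1 / recip_defect s)"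
proof -
  define N a b where "N = real (n + 1)" and "a = q_inv (- s)" and "b = q_inv s"
  define \<alpha> \<beta> where "\<alpha> = 1 - a ^ n / N" and "\<beta> = b ^ n / N - 1"
  note defs = N_def a_def b_def \<alpha>_def \<beta>_def
  have ab: "0 < a" "a < b"
    using assms by (auto simp: a_def b_def intro!: q_inv_pos q_inv_strict_mono)
  have "0 < \<alpha>" "0 < \<beta>" unfolding defs by (rule restoring_force_at_q_inv[OF assms])+
  moreover have "0 < N" by (simp add: N_def)
  ultimately have pos: "0 < a" "a < b" "0 < b" "0 < \<alpha>" "0 < \<beta>" "0 < N" using ab by auto
  have "s * q' b = b * \<beta>" "s * q' a = a * \<alpha>" unfolding defs by (rule restoring_force_at_q_inv[OF assms])+
  then have q': "q' b = b * \<beta> / s" "q' a = a * \<alpha> / s"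
    using assms(1) by (simp_all add: field_simps)
  have power: "b ^ n = N * (1 + \<beta>)" "a ^ n = N * (1 - \<alpha>)"
    using pos by (simp_all add: \<alpha>_def \<beta>_def)
  define P where "P = a * \<alpha> + b * \<beta>"
  have P: "0 < P" using pos by (simp add: P_def add_pos_pos)
  have one: "folded (\<lambda>u. 1) s = s * P / (a * b * \<alpha> * \<beta>)"
    using pos assms(1) by (simp add: P_def folded_def q' field_simps flip: a_def b_def)
  have "folded (\<lambda>u. u ^ n) s = N * (folded (\<lambda>u. 1) s - s * (b - a) / (a * b))"
    using pos assms(1) by (simp add: folded_def q' power field_simps flip: a_def b_def)
  then have "folded (\<lambda>u. u ^ n) s / folded (\<lambda>u. 1) s
      = N * ((folded (\<lambda>u. 1) s - s * (b - a) / (a * b)) / folded (\<lambda>u. 1) s)"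
    by simp
  also have "(folded (\<lambda>u. 1) s - s * (b - a) / (a * b)) / folded (\<lambda>u. 1) s
      = 1 - s * (b - a) / (a * b) / folded (\<lambda>u. 1) s"
    using folded_one_pos[of s] assms by (simp add: diff_divide_distrib)
  also have "s * (b - a) / (a * b) / folded (\<lambda>u. 1) s = (b - a) * \<alpha> * \<beta> / P"
    using pos P assms(1) unfolding one by (simp add: field_simps)
  also have "\<dots> = 1 / recip_defect s"
  proof -
    have "recip_defect s = P / ((b - a) * \<alpha> * \<beta>)"
      using pos unfolding P_def recip_defect_def a_def[symmetric] b_def[symmetric]
      unfolding N_def[symmetric] \<alpha>_def[symmetric] \<beta>_def[symmetric] by (simp add: divide_simps)
    then show ?thesis by simp
  qed
  finally show ?thesis by (simp add: N_def)
qed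

lemma folded_ratio_strict_decreasing:
  assumes n: "1 \<le> n" and s: "0 \<le> s" "s < t" "t < \<rho>"
  shows "folded (\<lambda>u. u ^ n) t / folded (\<lambda>u. 1) t < folded (\<lambda>u. u ^ n) s / folded (\<lambda>u. 1) s"
proof (cases "s = 0")
  case True
  have at_0: "0 < q_inv 0" "0 < q' (q_inv 0)" "q (q_inv 0) = 0" using s by (auto intro!: q_inv_pos q'_pos q_q_inv)
  then have "q_inv 0 * (q_inv 0 ^ n / real (n + 1) - 1) = 0" using restoring_force[of "q_inv 0"] by (simp del: of_nat_add)
  then have "q_inv 0 ^ n / real (n + 1) - 1 = 0" using at_0(1) unfolding mult_eq_0_iff by force
  then have "q_inv 0 ^ n = real (n + 1)" by (simp add: field_simps)
  then have "folded (\<lambda>u. u ^ n) s / folded (\<lambda>u. 1) s = real (n + 1)"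
    using True at_0 by (simp add: folded_def field_simps)
  moreover have "real (n + 1) * (1 - 1 / recip_defect t) < real (n + 1) * 1"
    using recip_defect_pos[of t] s by (intro mult_strict_left_mono) auto
  ultimately show ?thesis using folded_ratio[of t] s by simp
next
  case False
  then have "1 / recip_defect s < 1 / recip_defect t"
    using recip_defect_strict_decreasing[OF n, of s t] recip_defect_pos[of t] s by (intro divide_strict_left_mono mult_pos_pos recip_defect_pos) auto
  then show ?thesis using folded_ratio[of s] folded_ratio[of t] s False by simp
qed

end

section \<open>The potential of the system\<close>

text \<open>
  The polynomial \<open>\<Phi> - E\<close> has a double zero at \<open>c\<close> and is positive elsewhere on \<open>u \<ge> 0\<close>, so it is
  \<open>(u - c)\<^sup>2 * S u\<close> with \<open>S\<close> a polynomial positive there, and \<open>q u = (u - c) * sqrt (2 * S u)\<close> is differentiable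
  at \<open>c\<close> as well. The range of \<open>q\<close> contains \<open>(q 0, - q 0)\<close>, and \<open>(q 0)\<^sup>2 / 2 = - E\<close> is the
  height of the saddle above the center.
\<close>
lemma potential_is_square:
  assumes n: "1 \<le> n"
  obtains q q' where "squared_potential n q q' (sqrt (- 2 * center_energy n))"
    "\<And>u. 0 < u \<Longrightarrow> (q u)\<^sup>2 / 2 = u ^ (n + 2) / (real (n + 1) * real (n + 2)) - u\<^sup>2 / 2 - center_energy n"
proof -
  define E where "E = center_energy n"
  define c where "c = real (n + 1) powr (1 / real n)"
  have c_pos: "0 < c" by (simp add: c_def)
  have c_n: "c ^ n = real (n + 1)"
    using n by (simp add: c_def powr_powr flip: powr_realpow)
  have "c\<^sup>2 = real (n + 1) powr (2 / real n)"
    using n by (simp add: c_def powr_powr flip: powr_realpow[of _ 2])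
  then have E: "E = - (real n * c\<^sup>2 / (2 * real (n + 2)))"
    by (simp add: E_def center_energy_def)
  have E_neg: "E < 0" using n c_pos by (simp add: E divide_pos_pos)
  define \<kappa> where "\<kappa> = 1 / (real (n + 1) * real (n + 2))"
  have \<kappa>: "real (n + 2) * \<kappa> = 1 / real (n + 1)"
    by (simp only: \<kappa>_def times_divide_eq_right nonzero_divide_mult_cancel_right) simp
  define p where "p = monom \<kappa> (n + 2) + monom (- 1 / 2) 2 + [:- E:]"
  have p: "poly p u = u ^ (n + 2) / (real (n + 1) * real (n + 2)) - u\<^sup>2 / 2 - E" for u
    by (simp add: p_def poly_monom \<kappa>_def del: of_nat_add)
  have pderiv: "pderiv p = monom (1 / real (n + 1)) (n + 1) + monom (- 1) 1"
    unfolding p_def pderiv_add pderiv_monom \<kappa> by (simp add: pderiv_pCons)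
  have p': "poly (pderiv p) u = u ^ (n + 1) / real (n + 1) - u" for u
    by (simp add: pderiv poly_monom)
  have p'_alt: "poly (pderiv p) u = u * (u ^ n / real (n + 1) - 1)" for u
    by (simp add: p' algebra_simps)
  have p'': "poly (pderiv (pderiv p)) c = real n"
  proof -
    have "pderiv (pderiv p) = monom 1 n + monom (- 1) 0"
      unfolding pderiv pderiv_add pderiv_monom by simp
    then have "poly (pderiv (pderiv p)) c = c ^ n - 1" by (simp add: poly_monom)
    then show ?thesis by (simp add: c_n)
  qed
  have "poly p c = 0"
  proof -
    define m where "m = real (n + 2)"
    have m: "0 < m" "real n = m - 2" by (auto simp: m_def)
    have "c ^ (n + 2) / (real (n + 1) * m) = c\<^sup>2 / m"
      by (simp add: power_add power2_eq_square c_n del: of_nat_add)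
    then have "poly p c = c\<^sup>2 / m - c\<^sup>2 / 2 + (m - 2) * c\<^sup>2 / (2 * m)"
      by (simp only: p E m_def[symmetric] m(2))
    then show ?thesis using m(1) by (simp add: field_simps)
  qed
  define l where "l = [:- c, 1:]"
  have l: "poly l u = u - c" "pderiv l = 1" for u by (simp_all add: l_def pderiv_pCons)
  obtain r where r: "p = l * r"
    using \<open>poly p c = 0\<close> unfolding poly_eq_0_iff_dvd l_def by (elim dvdE)
  have "poly (pderiv p) c = 0" by (simp add: p'_alt c_n del: of_nat_add)
  then have "poly r c = 0" by (simp add: r pderiv_mult l)
  then obtain S where S: "r = l * S" unfolding poly_eq_0_iff_dvd l_def by (elim dvdE)
  have p_S: "poly p u = (u - c)\<^sup>2 * poly S u" for u
    by (simp add: r S l power2_eq_square)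
  have p'_S: "poly (pderiv p) u = 2 * (u - c) * poly S u + (u - c)\<^sup>2 * poly (pderiv S) u" for u
    by (simp add: r S pderiv_mult l power2_eq_square algebra_simps)
  have "poly (pderiv (pderiv p)) c = 2 * poly S c"
    by (simp add: r S pderiv_mult pderiv_add l)
  then have S_c: "0 < poly S c" using p'' n by simp
  have p'_pos: "0 < poly (pderiv p) u" if "c < u" for u
  proof -
    have "c ^ n < u ^ n" using that n c_pos by (intro power_strict_mono) auto
    then show ?thesis using that c_pos unfolding p'_alt c_n by (intro mult_pos_pos) (auto simp: field_simps)
  qed
  have p'_neg: "poly (pderiv p) u < 0" if "0 < u" "u < c" for u
  proof -
    have "u ^ n < c ^ n" using that n by (intro power_strict_mono) auto
    then show ?thesis using that unfolding p'_alt c_n by (intro mult_pos_neg) (auto simp: field_simps)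
  qed
  have p_pos: "0 < poly p u" if "0 \<le> u" "u \<noteq> c" for u
  proof (cases "u < c")
    case True
    have "poly p c < poly p u"
    proof (rule DERIV_neg_imp_decreasing_open[OF True])
      fix x assume "u < x" "x < c"
      then show "\<exists>y. (poly p has_real_derivative y) (at x) \<and> y < 0"
        using p'_neg[of x] that(1) by (intro exI[of _ "poly (pderiv p) x"] conjI poly_DERIV) auto
    qed (intro continuous_intros)
    then show ?thesis using \<open>poly p c = 0\<close> by simp
  next
    case False
    then have "c < u" using that by simp
    then have "poly p c < poly p u"
    proof (rule DERIV_pos_imp_increasing_open)
      fix x assume "c < x"
      then show "\<exists>y. (poly p has_real_derivative y) (at x) \<and> 0 < y"
        using p'_pos[of x] by (intro exI[of _ "poly (pderiv p) x"] conjI poly_DERIV) auto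
    qed (intro continuous_intros)
    then show ?thesis using \<open>poly p c = 0\<close> by simp
  qed
  have S_pos: "0 < poly S u" if "0 \<le> u" for u
    using S_c p_pos[OF that] by (cases "u = c") (auto simp: p_S zero_less_mult_iff)
  define q where "q = (\<lambda>u. (u - c) * sqrt (2 * poly S u))"
  define q' where "q' = (\<lambda>u. sqrt (2 * poly S u) + (u - c) * poly (pderiv S) u / sqrt (2 * poly S u))"
  have q_sq: "(q u)\<^sup>2 = 2 * poly p u" if "0 \<le> u" for u
    using S_pos[OF that] by (simp add: q_def p_S power_mult_distrib)
  have qq': "q u * q' u = poly (pderiv p) u" if "0 < u" for u
  proof -
    define w where "w = sqrt (2 * poly S u)"
    have w: "0 < w" "poly S u = w * w / 2" using S_pos[of u] that by (auto simp: w_def)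
    then show ?thesis
      unfolding q_def q'_def p'_S w_def[symmetric] by (simp add: field_simps power2_eq_square)
  qed
  have "squared_potential n q q' (sqrt (- 2 * E))"
  proof
    fix u :: real assume u: "0 < u"
    have "0 < sqrt (2 * poly S u)" using S_pos[of u] u by simp
    then show "(q has_real_derivative q' u) (at u)"
      unfolding q_def q'_def using S_pos[of u] u
      by (auto intro!: derivative_eq_intros simp: field_simps)
    show "0 < q' u"
    proof (cases u c rule: linorder_cases)
      case less
      then have "q u < 0" using S_pos[of u] u by (simp add: q_def mult_neg_pos)
      then show ?thesis using qq'[OF u] p'_neg[OF u less] by (smt (verit) mult_nonpos_nonpos)
    next
      case greater
      then have "0 < q u" using S_pos[of u] u by (simp add: q_def)
      moreover have "0 < q u * q' u" unfolding qq'[OF u] by (rule p'_pos[OF greater])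
      ultimately show ?thesis by (rule zero_less_mult_pos[rotated])
    qed (use S_c in \<open>simp add: q'_def\<close>)
    show "vector_field n (u, y) = (y, - (q u * q' u))" for y
      unfolding qq'[OF u] p' by (simp add: vector_field_def)
  next
    show "continuous_on {0<..} q'"
      unfolding q'_def by (intro continuous_intros) (use S_pos in \<open>auto simp: less_imp_le less_imp_neq[THEN not_sym]\<close>)
  next
    fix s assume s: "\<bar>s\<bar> < sqrt (- 2 * E)"
    have "(q 0)\<^sup>2 = - 2 * E" by (simp add: q_sq p)
    moreover have "q 0 \<le> 0" using c_pos S_pos[of 0] by (simp add: q_def)
    ultimately have "q 0 = - sqrt (- 2 * E)" by (metis abs_of_nonpos minus_minus real_sqrt_abs)
    then have q0: "q 0 < s" using s by simp
    \<comment> \<open>Any point with \<open>\<Phi> U \<ge> 0\<close> serves; this choice has \<open>U ^ n \<ge> U\<close>, so \<open>\<Phi> U \<ge> U\<^sup>2 / 2\<close>.\<close>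
    define U where "U = real (n + 1) * real (n + 2)"
    have "1 \<le> U" using mult_mono[of 1 "real (n + 1)" 1 "real (n + 2)"] by (simp add: U_def)
    then have U_n: "U ^ 1 \<le> U ^ n" using n by (intro power_increasing)
    have "real (n + 1) * 1 < U" unfolding U_def by (intro mult_strict_left_mono) auto
    with U_n have "c ^ n < U ^ n" by (simp add: c_n)
    then have "c < U" using \<open>1 \<le> U\<close> power_less_imp_less_base by fastforce
    have "poly p U = U\<^sup>2 * (U ^ n / U - 1 / 2) - E"
      unfolding p U_def[symmetric] by (simp add: power_add power2_eq_square algebra_simps)
    moreover have "1 \<le> U ^ n / U" using U_n \<open>1 \<le> U\<close> by (simp add: field_simps)
    then have "0 \<le> U ^ n / U - 1 / 2" by linarith
    then have "0 \<le> U\<^sup>2 * (U ^ n / U - 1 / 2)" by (intro mult_nonneg_nonneg zero_le_power2)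
    moreover have "(q U)\<^sup>2 = 2 * poly p U" using \<open>1 \<le> U\<close> by (intro q_sq) simp
    ultimately have "- 2 * E \<le> (q U)\<^sup>2" by linarith
    moreover have "0 \<le> q U" using \<open>c < U\<close> S_pos[of U] \<open>1 \<le> U\<close> by (simp add: q_def)
    ultimately have "sqrt (- 2 * E) \<le> q U" by (simp add: real_le_lsqrt)
    then have "s \<le> q U" using s by simp
    moreover have "continuous_on {0..U} q" unfolding q_def by (intro continuous_intros)
    ultimately obtain u where u: "0 \<le> u" "q u = s" using IVT'[of q 0 s U] q0 \<open>1 \<le> U\<close> by auto
    then have "u \<noteq> 0" using q0 by auto
    then show "\<exists>u>0. q u = s" using u by (intro exI[of _ u]) auto
  qed
  then show ?thesis
    using that[of q q'] q_sq by (simp add: E_def[symmetric] p)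
qed

theorem mainTheorem1:
  fixes n :: nat
  assumes "n \<ge> 1"
  shows "strict_antimono_on {center_energy n<..<0} (F_ratio n)"
proof -
  define E where "E = center_energy n"
  obtain q q' where sq: "squared_potential n q q' (sqrt (- 2 * E))"
    and q: "\<And>u. 0 < u \<Longrightarrow> (q u)\<^sup>2 / 2 = u ^ (n + 2) / (real (n + 1) * real (n + 2)) - u\<^sup>2 / 2 - E"
    using potential_is_square[OF assms] unfolding E_def by metis
  interpret squared_potential n q q' "sqrt (- 2 * E)" by (rule sq)
  define J where "J = (\<lambda>\<phi> R. integral {0..R} (\<lambda>s. folded \<phi> s * sqrt (R\<^sup>2 - s\<^sup>2)))"
  have oval: "oval n h = level (sqrt (2 * (h - E)))" if "E < h" for h
  proof -
    have "hamiltonian n p = h \<longleftrightarrow> (snd p)\<^sup>2 + (q (fst p))\<^sup>2 = 2 * (h - E)"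
      if "0 < fst p" for p
    proof -
      have "hamiltonian n p = (snd p)\<^sup>2 / 2 + (q (fst p))\<^sup>2 / 2 + E"
        unfolding hamiltonian_def q[OF that] by (simp add: case_prod_unfold)
      then show ?thesis by (auto simp: field_simps)
    qed
    then show ?thesis
      unfolding oval_def level_def using that by (intro Collect_cong conj_cong refl) simp
  qed
  have F: "F_ratio n h = J (\<lambda>u. u ^ n) (sqrt (2 * (h - E))) / J (\<lambda>u. 1) (sqrt (2 * (h - E)))"
    if "E < h" "h < 0" for h
  proof -
    have R: "0 < sqrt (2 * (h - E))" "sqrt (2 * (h - E)) < sqrt (- 2 * E)" using that by auto
    show ?thesis
      using line_integral_du_level[OF R, of "\<lambda>u. u ^ n"] line_integral_du_level[OF R, of "\<lambda>u. 1"]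
      by (simp add: F_ratio_def oval that J_def continuous_intros)
  qed
  show ?thesis
  proof (rule monotone_onI)
    fix h h' assume "h \<in> {center_energy n<..<0}" "h' \<in> {center_energy n<..<0}" "h < h'"
    then have h: "E < h" "h < h'" "h' < 0" by (auto simp: E_def)
    define r r' where "r = sqrt (2 * (h - E))" and "r' = sqrt (2 * (h' - E))"
    have r: "0 < r" "r < r'" "r' < sqrt (- 2 * E)" using h by (auto simp: r_def r'_def)
    then have "J (\<lambda>u. u ^ n) r' / J (\<lambda>u. 1) r' < J (\<lambda>u. u ^ n) r / J (\<lambda>u. 1) r"
      unfolding J_def
      by (intro weighted_ratio_decreasing folded_continuous_on folded_one_pos
          folded_ratio_strict_decreasing assms continuous_intros) auto
    then show "F_ratio n h' < F_ratio n h" using h by (simp add: F r_def r'_def)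
  qed
qed

end
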